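(* For every $\delta>0$ there are constants $C(\delta)>0$ and $\tilde C(\delta)>0$, depending only on $\delta$, such that for every integer $n\ge1$ and every continuous time irreducible Markov chain $X$ on $I=\{1,\ldots,n\}$ which is reversible with respect to the uniform distribution on $I$ (in particular the constants depend neither on $n$ nor on the particular Markov chain): (a) for all initial states $a\in I$, $$\int_0^\infty \mathbf{1}_{\{t\geq0:\;\|P^a_{3t}-P^a_t\|_{TV}\geq\delta\}}\;\frac{1}{t}\,\mathrm{d}t \leq C(\delta)\log n;$$ (b) for all pairs $(a,b)\in I^2$ of initial states, $$\int_0^\infty \mathbf{1}_{\{t\geq0:\;\|P^a_{t}-P^b_{t}\|_{TV}-\|P^a_{3t}-P^b_{3t}\|_{TV}\geq\delta\}}\;\frac{1}{t}\,\mathrm{d}t \leq \tilde{C}(\delta)\log n.$$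
   Context: For $a\in I$ and $t\ge0$, $P^a_t$ denotes the distribution of $X(t)$ when $X(0)=a$. The total variation norm of a signed measure $\pi$ on $I$ is $\|\pi\|_{TV}=\sum_{i\in I}|\pi(i)|$. Logarithms are natural. *)

theory Defs
  imports "HOL-Probability.Probability"
begin

(* Right-continuous paths [0,\<infinity>) \<rightarrow> {1..n}; the topology on nat is discrete, so a path is constant
   on some interval [t, t + \<epsilon>) for every t. *)
definition paths :: "nat \<Rightarrow> (real \<Rightarrow> nat) set" where
  "paths n = {\<omega> \<in> {0..} \<rightarrow>\<^sub>E {1..n}. \<forall>t\<ge>0. continuous (at_right t) \<omega>}"

definition path_space :: "nat \<Rightarrow> (real \<Rightarrow> nat) measure" where
  "path_space n = restrict_space (PiM {0..} (\<lambda>_. count_space {1..n})) (paths n)"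

definition past :: "nat \<Rightarrow> real \<Rightarrow> (real \<Rightarrow> nat) set set" where
  "past n s = sigma_sets (paths n) {{\<omega> \<in> paths n. \<omega> u = i} | u i. 0 \<le> u \<and> u \<le> s}"

(* A time-homogeneous continuous time Markov chain on {1..n}, in canonical form: X a is the law,
   on path space, of the chain started in a, and the value at time t is the coordinate \<omega> t.
   Using the canonical sample space loses no generality, since all quantities of interest depend
   only on these laws, and it avoids a type variable for the sample space, on which constants
   quantified in front of the chain could depend. *)
locale markov_chain =
  fixes n :: nat and X :: "nat \<Rightarrow> (real \<Rightarrow> nat) measure"
  assumes prob_space_law: "a \<in> {1..n} \<Longrightarrow> prob_space (X a)"
    and sets_law: "a \<in> {1..n} \<Longrightarrow> sets (X a) = sets (path_space n)"
    and start: "a \<in> {1..n} \<Longrightarrow> measure (X a) {\<omega> \<in> paths n. \<omega> 0 = a} = 1"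
    and markov: "\<lbrakk>a \<in> {1..n}; i \<in> {1..n}; j \<in> {1..n}; 0 \<le> s; 0 \<le> t; A \<in> past n s\<rbrakk> \<Longrightarrow>
      measure (X a) {\<omega> \<in> A. \<omega> s = i \<and> \<omega> (s + t) = j} =
      measure (X a) {\<omega> \<in> A. \<omega> s = i} * measure (X i) {\<omega> \<in> paths n. \<omega> t = j}"

definition law_at :: "nat \<Rightarrow> (nat \<Rightarrow> (real \<Rightarrow> nat) measure) \<Rightarrow> nat \<Rightarrow> real \<Rightarrow> nat measure" where
  "law_at n X a t = distr (X a) (count_space {1..n}) (\<lambda>\<omega>. \<omega> t)"

definition irreducible_chain :: "nat \<Rightarrow> (nat \<Rightarrow> (real \<Rightarrow> nat) measure) \<Rightarrow> bool" where
  "irreducible_chain n X \<longleftrightarrow>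
     (\<forall>a\<in>{1..n}. \<forall>b\<in>{1..n}. \<exists>t\<ge>0. measure (law_at n X a t) {b} > 0)"

definition reversible_wrt :: "nat \<Rightarrow> (nat \<Rightarrow> (real \<Rightarrow> nat) measure) \<Rightarrow> nat pmf \<Rightarrow> bool" where
  "reversible_wrt n X \<pi> \<longleftrightarrow>
     (\<forall>t\<ge>0. \<forall>a\<in>{1..n}. \<forall>b\<in>{1..n}.
        pmf \<pi> a * measure (law_at n X a t) {b} = pmf \<pi> b * measure (law_at n X b t) {a})"

(* Total variation norm of the signed measure \<mu> - \<nu> on {1..n}, without the factor 1/2. *)
definition tv_dist :: "nat \<Rightarrow> nat measure \<Rightarrow> nat measure \<Rightarrow> real" where
  "tv_dist n \<mu> \<nu> = (\<Sum>i\<in>{1..n}. \<bar>measure \<mu> {i} - measure \<nu> {i}\<bar>)"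

end

theory Submission imports Defs begin

text \<open>
  (a) Let \<open>H t\<close> be the relative entropy of the law at time \<open>t\<close> with respect to the uniform
  distribution; it decreases in \<open>t\<close> and lies between \<open>0\<close> and \<open>ln n\<close>. Write \<open>p\<close> for the law at time
  \<open>t\<close> and \<open>P\<close> for the symmetric transition matrix over a time step \<open>s\<close>. Since \<open>P\<close> averages, concavity
  of the logarithm gives \<open>H t - H (t + s) \<ge> KL(p, p P P)\<close>, and \<open>p P P\<close> is the law at time \<open>t + 2 s\<close>.
  With \<open>s = t\<close> and Pinsker's inequality, a distance of at least \<open>\<delta>\<close> between the laws at \<open>t\<close> and \<open>3 t\<close>
  forces \<open>H t - H (2 t)\<close> to be of order \<open>\<delta>\<^sup>2\<close>. For decreasing \<open>h\<close> with values in \<open>[0, M]\<close> the integral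
  of \<open>(h t - h (c t)) / t\<close> telescopes, by scale invariance of \<open>dt / t\<close>, to at most \<open>M ln c\<close>.

  (b) The telescoping bound applies to \<open>h\<close> the distance of the two laws, which decreases, is at
  most \<open>2\<close>, and vanishes for \<open>n = 1\<close>.
\<close>

section \<open>Drops of a decreasing function, integrated against \<open>dt / t\<close>\<close>

lemma borel_measurable_antimono:
  fixes g :: "real \<Rightarrow> real"
  assumes "antimono g"
  shows "g \<in> borel_measurable borel"
proof -
  have "(\<lambda>t. - g t) \<in> borel_measurable borel"
    using assms by (intro borel_measurable_mono) (auto simp: mono_def antimono_def)
  then show ?thesis by simp
qed

lemma ennreal_cancel_right_le: "a \<le> b" if "a + x \<le> b + x" "x < \<infinity>" for a b x :: ennreal
  using that by (metis ennreal_add_left_cancel_le add.commute infinity_ennreal_def less_irrefl)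

lemma nn_integral_inverse_Icc:
  fixes a c M :: real
  assumes "0 < a" "1 \<le> c" "0 \<le> M"
  shows "(\<integral>\<^sup>+t\<in>{a..c * a}. ennreal (M / t) \<partial>lborel) = ennreal (M * ln c)"
proof -
  have le: "a \<le> c * a" using assms by simp
  have "(\<integral>\<^sup>+t. ennreal (M / t) * indicator {a..c * a} t \<partial>lborel)
      = ennreal (M * ln (c * a) - M * ln a)"
  proof (rule nn_integral_FTC_Icc)
    show "((\<lambda>t. M * ln t) has_real_derivative M / t) (at t)" if "t \<in> {a..c * a}" for t
      using that \<open>0 < a\<close> by (auto intro!: derivative_eq_intros)
  qed (use le assms in auto)
  moreover have "M * ln (c * a) - M * ln a = M * ln c"
    using assms by (simp add: ln_mult algebra_simps)
  ultimately show ?thesis by simp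
qed

text \<open>Substituting \<open>c * t\<close> for \<open>t\<close> moves the integral of
  \<open>g (c * t) / t\<close> from \<open>{a..b}\<close> to that of \<open>g t / t\<close> over
  \<open>{c * a..c * b}\<close>. What it leaves uncovered in \<open>{a..b}\<close> lies in
  \<open>{a..c * a}\<close>, where \<open>g\<close> is at most \<open>M\<close>; this costs at most
  \<open>M * ln c\<close>, whatever \<open>a\<close> and \<open>b\<close> are.\<close>

lemma nn_integral_scale_drop_Icc_le:
  fixes g :: "real \<Rightarrow> real"
  assumes anti: "antimono g" and nonneg: "\<And>t. 0 \<le> g t" and bound: "\<And>t. g t \<le> M"
    and "1 \<le> c" "0 < a" "a \<le> b"
  shows "(\<integral>\<^sup>+t\<in>{a..b}. ennreal ((g t - g (c * t)) / t) \<partial>lborel) \<le> ennreal (M * ln c)"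
proof -
  have [measurable]: "g \<in> borel_measurable borel" by (rule borel_measurable_antimono[OF anti])
  have M: "0 \<le> M" using nonneg[of 0] bound[of 0] by linarith
  let ?A = "\<integral>\<^sup>+t\<in>{a..b}. ennreal ((g t - g (c * t)) / t) \<partial>lborel"
  let ?B = "\<integral>\<^sup>+t\<in>{a..b}. ennreal (g (c * t) / t) \<partial>lborel"
  let ?B' = "\<integral>\<^sup>+t\<in>{c * a..c * b}. ennreal (g t / t) \<partial>lborel"
  have drop: "g (c * t) \<le> g t" if "0 < t" for t
    using anti that \<open>1 \<le> c\<close> by (auto simp: antimono_def)
  have B: "?B' = ?B"
  proof -
    have "?B' = ennreal \<bar>c\<bar> * (\<integral>\<^sup>+t. ennreal (g (0 + c * t) / (0 + c * t)) * indicator {c * a..c * b} (0 + c * t) \<partial>lborel)"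
      using \<open>1 \<le> c\<close> by (intro nn_integral_real_affine) auto
    also have "\<dots> = (\<integral>\<^sup>+t. ennreal \<bar>c\<bar> * (ennreal (g (0 + c * t) / (0 + c * t)) * indicator {c * a..c * b} (0 + c * t)) \<partial>lborel)"
      by (rule nn_integral_cmult[symmetric]) measurable
    also have "\<dots> = ?B"
      using \<open>1 \<le> c\<close> \<open>0 < a\<close> nonneg
      by (intro nn_integral_cong) (auto simp: indicator_def ennreal_mult[symmetric])
    finally show ?thesis .
  qed
  \<comment> \<open>To avoid subtracting extended integrals, \<open>?B\<close> is added on both
    sides and cancelled at the end; it is finite because \<open>{a..b}\<close> is bounded and stays
    away from \<open>0\<close>.\<close>
  have "?A + ?B = (\<integral>\<^sup>+t. ennreal ((g t - g (c * t)) / t) * indicator {a..b} t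
      + ennreal (g (c * t) / t) * indicator {a..b} t \<partial>lborel)"
    by (rule nn_integral_add[symmetric]) measurable
  also have "\<dots> \<le> (\<integral>\<^sup>+t. ennreal (M / t) * indicator {a..c * a} t
      + ennreal (g t / t) * indicator {c * a..c * b} t \<partial>lborel)"
  proof (rule nn_integral_mono)
    fix t
    have "b \<le> c * b" using \<open>1 \<le> c\<close> \<open>0 < a\<close> \<open>a \<le> b\<close> by simp
    have sum: "ennreal ((g t - g (c * t)) / t) + ennreal (g (c * t) / t) = ennreal (g t / t)" if "0 < t"
      using that drop[OF that] nonneg
      by (simp add: ennreal_plus[symmetric] add_divide_distrib[symmetric] del: ennreal_plus)
    have le: "ennreal (g t / t) \<le> ennreal (M / t)" if "0 < t"
      using that bound by (auto intro!: ennreal_leI divide_right_mono)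
    show "ennreal ((g t - g (c * t)) / t) * indicator {a..b} t
      + ennreal (g (c * t) / t) * indicator {a..b} t \<le> ennreal (M / t) * indicator {a..c * a} t
      + ennreal (g t / t) * indicator {c * a..c * b} t"
      using sum le \<open>0 < a\<close> \<open>b \<le> c * b\<close> by (auto simp: indicator_def intro: add_increasing2)
  qed
  also have "\<dots> = (\<integral>\<^sup>+t\<in>{a..c * a}. ennreal (M / t) \<partial>lborel) + ?B'"
    by (rule nn_integral_add) measurable
  also have "\<dots> = ennreal (M * ln c) + ?B"
    using nn_integral_inverse_Icc[OF \<open>0 < a\<close> \<open>1 \<le> c\<close> M] B by simp
  finally have "?A + ?B \<le> ennreal (M * ln c) + ?B" .
  moreover have "?B < \<infinity>"
  proof -
    have "?B \<le> (\<integral>\<^sup>+t. ennreal (M / a) * indicator {a..b} t \<partial>lborel)"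
      using nonneg bound \<open>0 < a\<close> M
      by (intro nn_integral_mono) (auto simp: indicator_def intro!: ennreal_leI frac_le)
    also have "\<dots> = ennreal (M / a) * emeasure lborel {a..b}"
      by (rule nn_integral_cmult_indicator) simp
    also have "\<dots> < \<infinity>"
      using \<open>a \<le> b\<close> by (simp add: ennreal_mult_less_top)
    finally show ?thesis .
  qed
  ultimately show ?thesis by (rule ennreal_cancel_right_le)
qed

text \<open>The integral of \<open>g t / t\<close> may diverge on the half-line, so the cancellation
  is done on compact intervals. The bound does not depend on the interval and passes to the limit by
  continuity from below of the measure with density \<open>?G\<close>.\<close>

lemma nn_integral_scale_drop_le:
  fixes g :: "real \<Rightarrow> real"
  assumes anti: "antimono g" and nonneg: "\<And>t. 0 \<le> g t" and bound: "\<And>t. g t \<le> M" and "1 \<le> c"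
  shows "(\<integral>\<^sup>+t\<in>{0<..}. ennreal ((g t - g (c * t)) / t) \<partial>lborel) \<le> ennreal (M * ln c)"
proof -
  have [measurable]: "g \<in> borel_measurable borel" by (rule borel_measurable_antimono[OF anti])
  let ?G = "\<lambda>t. ennreal ((g t - g (c * t)) / t)"
  let ?I = "\<lambda>k::nat. {1 / real (Suc k)..real (Suc k)}"
  have [measurable]: "?G \<in> borel_measurable lborel" by measurable
  have un: "{0<..} = (\<Union>k. ?I k)"
  proof (intro equalityI subsetI)
    fix t :: real assume "t \<in> {0<..}"
    then have "0 < t" by simp
    obtain k :: nat where k: "max t (1 / t) < real k" using reals_Archimedean2 by blast
    then have "1 / t < real (Suc k)" by simp
    then have "1 / real (Suc k) \<le> t" using \<open>0 < t\<close> by (simp add: field_simps)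
    with k show "t \<in> (\<Union>k. ?I k)" by force
  next
    fix t :: real assume "t \<in> (\<Union>k. ?I k)"
    then obtain k where "1 / real (Suc k) \<le> t" by auto
    moreover have "0 < 1 / real (Suc k)" by simp
    ultimately show "t \<in> {0<..}" by (simp only: greaterThan_iff)
  qed
  have "(\<integral>\<^sup>+t\<in>{0<..}. ?G t \<partial>lborel) = emeasure (density lborel ?G) (\<Union>k. ?I k)"
    unfolding un[symmetric] by (subst emeasure_density) auto
  also have "\<dots> = (SUP k. emeasure (density lborel ?G) (?I k))"
  proof (rule SUP_emeasure_incseq[symmetric])
    show "incseq ?I"
      by (rule incseq_SucI) (auto simp: frac_le intro: order_trans)
  qed auto
  also have "\<dots> \<le> ennreal (M * ln c)"
  proof (rule SUP_least)
    fix k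
    have "1 / real (Suc k) \<le> real (Suc k)" by (simp add: field_simps)
    then show "emeasure (density lborel ?G) (?I k) \<le> ennreal (M * ln c)"
      using nn_integral_scale_drop_Icc_le[OF anti nonneg bound \<open>1 \<le> c\<close>, of "1 / real (Suc k)" "real (Suc k)"]
      by (subst emeasure_density) auto
  qed
  finally show ?thesis .
qed

text \<open>A Markov-type inequality: on \<open>E\<close> the indicator is at most
  \<open>(h t - h (c * t)) / \<eta>\<close>, to which the telescoping bound applies.\<close>

lemma nn_integral_large_drop_le:
  fixes h :: "real \<Rightarrow> real"
  assumes anti: "\<And>s t. 0 \<le> s \<Longrightarrow> s \<le> t \<Longrightarrow> h t \<le> h s"
    and nonneg: "\<And>t. 0 \<le> t \<Longrightarrow> 0 \<le> h t" and bound: "\<And>t. 0 \<le> t \<Longrightarrow> h t \<le> M"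
    and "1 \<le> c" "0 < \<eta>" and E: "\<And>t. t \<in> E \<Longrightarrow> 0 \<le> t \<and> h t - h (c * t) \<ge> \<eta>"
  shows "(\<integral>\<^sup>+t\<in>{0..}. ennreal (indicator E t * (1 / t)) \<partial>lborel) \<le> ennreal (M * ln c / \<eta>)"
proof -
  \<comment> \<open>Extending \<open>h\<close> by its value at \<open>0\<close> makes it decreasing
    on the whole real line.\<close>
  define g where "g t = h (max 0 t) / \<eta>" for t
  have "(\<integral>\<^sup>+t\<in>{0..}. ennreal (indicator E t * (1 / t)) \<partial>lborel)
      \<le> (\<integral>\<^sup>+t\<in>{0<..}. ennreal ((g t - g (c * t)) / t) \<partial>lborel)"
  proof (rule nn_integral_mono)
    fix t :: real
    have "1 / t \<le> (g t - g (c * t)) / t" if "t \<in> E" "0 < t"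
    proof -
      have "1 \<le> g t - g (c * t)"
        using E[OF that(1)] that(2) \<open>0 < \<eta>\<close> \<open>1 \<le> c\<close>
        by (simp add: g_def diff_divide_distrib[symmetric])
      then show ?thesis using that(2) by (intro divide_right_mono) auto
    qed
    \<comment> \<open>At \<open>t = 0\<close> the integrand is \<open>0\<close>, since
      \<open>1 / 0 = 0\<close>; the domain can thus shrink to \<open>{0<..}\<close>.\<close>
    then show "ennreal (indicator E t * (1 / t)) * indicator {0..} t
        \<le> ennreal ((g t - g (c * t)) / t) * indicator {0<..} t"
      by (cases "t = 0") (auto simp: indicator_def intro: ennreal_leI)
  qed
  also have "\<dots> \<le> ennreal (M / \<eta> * ln c)"
  proof (rule nn_integral_scale_drop_le)
    show "antimono g"
      using anti \<open>0 < \<eta>\<close> by (auto simp: antimono_def g_def intro!: divide_right_mono)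
  qed (use nonneg bound \<open>0 < \<eta>\<close> \<open>1 \<le> c\<close> in \<open>auto simp: g_def intro!: divide_right_mono\<close>)
  finally show ?thesis by simp
qed

section \<open>Total variation, Hellinger distance and relative entropy of discrete
  distributions\<close>

text \<open>Cauchy-Schwarz for the factorization of \<open>p x - q x\<close> as a difference of
  squares of square roots; the squared sums of roots add up to at most
  \<open>2 * (1 + 1) = 4\<close>.\<close>

lemma hellinger_tv:
  fixes p q :: "'a \<Rightarrow> real"
  assumes p: "\<And>x. x \<in> I \<Longrightarrow> 0 \<le> p x" "sum p I = 1" and q: "\<And>x. x \<in> I \<Longrightarrow> 0 \<le> q x" "sum q I = 1"
  shows "(\<Sum>x\<in>I. \<bar>p x - q x\<bar>)\<^sup>2 \<le> 4 * (\<Sum>x\<in>I. (sqrt (p x) - sqrt (q x))\<^sup>2)"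
proof -
  have "(\<Sum>x\<in>I. \<bar>p x - q x\<bar>) = (\<Sum>x\<in>I. \<bar>sqrt (p x) - sqrt (q x)\<bar> * (sqrt (p x) + sqrt (q x)))"
  proof (rule sum.cong[OF refl])
    fix x assume "x \<in> I"
    then have "p x - q x = (sqrt (p x) - sqrt (q x)) * (sqrt (p x) + sqrt (q x))"
      using p q by (simp add: algebra_simps)
    then show "\<bar>p x - q x\<bar> = \<bar>sqrt (p x) - sqrt (q x)\<bar> * (sqrt (p x) + sqrt (q x))"
      using p q \<open>x \<in> I\<close> by (simp add: abs_mult)
  qed
  then have cs: "(\<Sum>x\<in>I. \<bar>p x - q x\<bar>)\<^sup>2 \<le>
      (\<Sum>x\<in>I. \<bar>sqrt (p x) - sqrt (q x)\<bar>\<^sup>2) * (\<Sum>x\<in>I. (sqrt (p x) + sqrt (q x))\<^sup>2)"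
    using Cauchy_Schwarz_ineq_sum by metis
  have "(\<Sum>x\<in>I. (sqrt (p x) + sqrt (q x))\<^sup>2) \<le> (\<Sum>x\<in>I. 2 * (p x + q x))"
  proof (rule sum_mono)
    fix x assume "x \<in> I"
    then show "(sqrt (p x) + sqrt (q x))\<^sup>2 \<le> 2 * (p x + q x)"
      using p q arith_geo_mean_sqrt[of "p x" "q x"]
      by (simp add: power2_sum real_sqrt_mult)
  qed
  also have "\<dots> = 4" using p q by (simp add: sum_distrib_left[symmetric] sum.distrib)
  finally have "(\<Sum>x\<in>I. (sqrt (p x) + sqrt (q x))\<^sup>2) \<le> 4" .
  then have "(\<Sum>x\<in>I. \<bar>sqrt (p x) - sqrt (q x)\<bar>\<^sup>2) * (\<Sum>x\<in>I. (sqrt (p x) + sqrt (q x))\<^sup>2)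
      \<le> (\<Sum>x\<in>I. (sqrt (p x) - sqrt (q x))\<^sup>2) * 4"
    unfolding power2_abs by (intro mult_left_mono sum_nonneg) auto
  with cs show ?thesis by linarith
qed

text \<open>A weak form of Pinsker's inequality, with constant \<open>1/4\<close> in place of \<open>1/2\<close>.\<close>

lemma kl_tv:
  fixes p q :: "'a \<Rightarrow> real"
  assumes p: "\<And>x. x \<in> I \<Longrightarrow> 0 \<le> p x" "sum p I = 1" and q: "\<And>x. x \<in> I \<Longrightarrow> 0 \<le> q x" "sum q I = 1"
    and ac: "\<And>x. x \<in> I \<Longrightarrow> 0 < p x \<Longrightarrow> 0 < q x"
  shows "(\<Sum>x\<in>I. \<bar>p x - q x\<bar>)\<^sup>2 \<le> 4 * (\<Sum>x\<in>I. p x * (ln (p x) - ln (q x)))"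
proof -
  have "(\<Sum>x\<in>I. (sqrt (p x) - sqrt (q x))\<^sup>2) = (\<Sum>x\<in>I. (p x - 2 * sqrt (p x) * sqrt (q x)) + q x)"
    using p q by (intro sum.cong) (auto simp: power2_diff)
  \<comment> \<open>Both total masses are \<open>1\<close>, so \<open>q x\<close> may be traded for
    a second \<open>p x\<close>. Only in this form does the comparison with relative entropy hold
    term by term, by \<open>ln u \<le> u - 1\<close> at \<open>u = sqrt (q x / p x)\<close>.\<close>
  also have "\<dots> = (\<Sum>x\<in>I. 2 * p x - 2 * sqrt (p x) * sqrt (q x))"
    using p q by (simp add: sum.distrib sum_subtractf sum_distrib_left[symmetric])
  also have "\<dots> \<le> (\<Sum>x\<in>I. p x * (ln (p x) - ln (q x)))"
  proof (rule sum_mono)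
    fix x assume x: "x \<in> I"
    show "2 * p x - 2 * sqrt (p x) * sqrt (q x) \<le> p x * (ln (p x) - ln (q x))"
    proof (cases "p x = 0")
      case False
      with x p ac have pos: "0 < p x" "0 < q x" by (auto simp: less_le)
      have "ln (sqrt (q x / p x)) \<le> sqrt (q x / p x) - 1"
        using pos by (intro ln_le_minus_one) auto
      then have "ln (q x) - ln (p x) \<le> 2 * (sqrt (q x / p x) - 1)"
        using pos by (simp add: ln_sqrt ln_div)
      then have "p x * (ln (q x) - ln (p x)) \<le> p x * (2 * (sqrt (q x / p x) - 1))"
        using pos by (intro mult_left_mono) auto
      moreover have "p x * sqrt (q x / p x) = sqrt (p x) * sqrt (q x)"
        using pos by (simp add: real_sqrt_divide field_simps)
      ultimately show ?thesis by (simp add: algebra_simps)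
    qed simp
  qed
  finally have "4 * (\<Sum>x\<in>I. (sqrt (p x) - sqrt (q x))\<^sup>2) \<le> 4 * (\<Sum>x\<in>I. p x * (ln (p x) - ln (q x)))"
    by simp
  with hellinger_tv[OF p q] show ?thesis by linarith
qed

section \<open>Entropy under a symmetric stochastic matrix\<close>

text \<open>Moving \<open>P\<close> from the measure to the function turns the sum of
  \<open>r x * ln (r x)\<close> into the \<open>p\<close>-mean of the \<open>P\<close>-averages of
  \<open>ln r\<close>. By Jensen such an average is at most the logarithm of the
  \<open>P\<close>-average of \<open>r\<close>, which by symmetry of \<open>P\<close> is
  \<open>q\<close>. Hence the entropy drop dominates the relative entropy of \<open>p\<close> with
  respect to \<open>q\<close>, and \<open>kl_tv\<close> applies.\<close>

lemma entropy_drop: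
  fixes p r :: "'a \<Rightarrow> real" and P :: "'a \<Rightarrow> 'a \<Rightarrow> real"
  assumes fin: "finite I"
    and P: "\<And>x y. x \<in> I \<Longrightarrow> y \<in> I \<Longrightarrow> 0 \<le> P x y" "\<And>x. x \<in> I \<Longrightarrow> (\<Sum>y\<in>I. P x y) = 1"
      "\<And>x y. x \<in> I \<Longrightarrow> y \<in> I \<Longrightarrow> P x y = P y x"
    and p: "\<And>x. x \<in> I \<Longrightarrow> 0 \<le> p x" "sum p I = 1"
    and r: "\<And>y. y \<in> I \<Longrightarrow> r y = (\<Sum>x\<in>I. p x * P x y)"
    and q: "\<And>y. y \<in> I \<Longrightarrow> q y = (\<Sum>x\<in>I. r x * P x y)"
  shows "(\<Sum>x\<in>I. \<bar>p x - q x\<bar>)\<^sup>2 \<le> 4 * ((\<Sum>x\<in>I. p x * ln (p x)) - (\<Sum>x\<in>I. r x * ln (r x)))"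
proof -
  have push: "(\<Sum>y\<in>I. (\<Sum>x\<in>I. u x * P x y) * v y) = (\<Sum>x\<in>I. u x * (\<Sum>y\<in>I. P x y * v y))"
    for u v :: "'a \<Rightarrow> real"
    unfolding sum_distrib_left sum_distrib_right by (subst sum.swap) (simp add: mult.assoc)
  have push1: "(\<Sum>y\<in>I. \<Sum>x\<in>I. u x * P x y) = sum u I" for u
    using push[of u "\<lambda>_. 1"] P(2) by simp
  have r0: "0 \<le> r y" if "y \<in> I" for y
    using that p P by (auto simp: r intro!: sum_nonneg)
  have q0: "0 \<le> q y" if "y \<in> I" for y
    using that r0 P by (auto simp: q intro!: sum_nonneg)
  have r1: "sum r I = 1" using push1[of p] p r by simp
  have q1: "sum q I = 1" using push1[of r] r1 q by simp
  have rpos: "0 < r y" if "x \<in> I" "y \<in> I" "0 < p x" "0 < P x y" for x y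
  proof -
    have "p x * P x y \<le> r y"
      unfolding r[OF \<open>y \<in> I\<close>] using that P p fin by (intro member_le_sum) auto
    moreover have "0 < p x * P x y" using that by simp
    ultimately show ?thesis by linarith
  qed
  \<comment> \<open>Some \<open>y\<close> is reached from \<open>x\<close> with positive
    probability, and symmetry permits the return. This is the absolute continuity that
    \<open>kl_tv\<close> asks for.\<close>
  have qpos: "0 < q x" if x: "x \<in> I" "0 < p x" for x
  proof -
    have "(\<Sum>y\<in>I. P x y) \<noteq> 0" using P(2) x by simp
    then obtain y where "y \<in> I" "P x y \<noteq> 0" by (meson sum.neutral)
    then have y: "y \<in> I" "0 < P x y" using P(1) x by (auto simp: less_le)
    have "r y * P y x \<le> q x"
      unfolding q[OF \<open>x \<in> I\<close>] using x y P r0 fin by (intro member_le_sum[of y I "\<lambda>y. r y * P y x"]) auto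
    moreover have "0 < r y * P y x" using rpos[OF x(1) y(1) x(2) y(2)] y P(3) x by simp
    ultimately show ?thesis by linarith
  qed
  \<comment> \<open>The factor \<open>p x\<close> stays: where \<open>p x = 0\<close>, some
    \<open>r y\<close> with \<open>P x y > 0\<close> may vanish, and the default
    \<open>ln 0 = 0\<close> can then break Jensen's inequality.\<close>
  have jensen: "p x * (\<Sum>y\<in>I. P x y * ln (r y)) \<le> p x * ln (q x)" if x: "x \<in> I" for x
  proof (cases "p x = 0")
    case False
    with p x have px: "0 < p x" by (auto simp: less_le)
    \<comment> \<open>Jensen by the tangent line \<open>ln u \<le> u - 1\<close> at
      \<open>u = r y / q x\<close>; the \<open>P\<close>-average of the right-hand side is
      \<open>0\<close>.\<close>
    have "(\<Sum>y\<in>I. P x y * (ln (r y) - ln (q x))) \<le> (\<Sum>y\<in>I. P x y * (r y / q x - 1))"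
    proof (rule sum_mono)
      fix y assume y: "y \<in> I"
      show "P x y * (ln (r y) - ln (q x)) \<le> P x y * (r y / q x - 1)"
      proof (cases "P x y = 0")
        case False
        with P x y have "0 < P x y" by (auto simp: less_le)
        moreover from this have "ln (r y / q x) \<le> r y / q x - 1"
          using rpos[OF x y px] qpos[OF x px] by (intro ln_le_minus_one) auto
        ultimately show ?thesis
          using rpos[OF x y px] qpos[OF x px] by (simp add: ln_div)
      qed simp
    qed
    also have "\<dots> = (\<Sum>y\<in>I. r y * P y x) / q x - (\<Sum>y\<in>I. P x y)"
      using P(3) x by (simp add: sum_divide_distrib sum_subtractf[symmetric] algebra_simps cong: sum.cong)
    also have "\<dots> = 0" using q[OF x] qpos[OF x px] P(2)[OF x] by simp
    finally have "(\<Sum>y\<in>I. P x y * ln (r y)) \<le> ln (q x)"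
      using P(2)[OF x] by (simp add: right_diff_distrib sum_subtractf sum_distrib_right[symmetric])
    with px show ?thesis by simp
  qed simp
  have "(\<Sum>x\<in>I. r x * ln (r x)) = (\<Sum>x\<in>I. p x * (\<Sum>y\<in>I. P x y * ln (r y)))"
    using push[of p "\<lambda>y. ln (r y)"] r by simp
  also have "\<dots> \<le> (\<Sum>x\<in>I. p x * ln (q x))" by (intro sum_mono jensen)
  finally have "(\<Sum>x\<in>I. p x * (ln (p x) - ln (q x)))
      \<le> (\<Sum>x\<in>I. p x * ln (p x)) - (\<Sum>x\<in>I. r x * ln (r x))"
    by (simp add: right_diff_distrib sum_subtractf)
  moreover have "(\<Sum>x\<in>I. \<bar>p x - q x\<bar>)\<^sup>2 \<le> 4 * (\<Sum>x\<in>I. p x * (ln (p x) - ln (q x)))"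
    by (rule kl_tv) (use p q0 q1 qpos in auto)
  ultimately show ?thesis by (smt (verit))
qed

text \<open>The first expression is the relative entropy with respect to the uniform distribution,
  and \<open>kl_tv\<close> bounds a square by four times it. The second bound holds term by term, as
  probabilities are at most \<open>1\<close>.\<close>

lemma entropy_bounds:
  fixes p :: "'a \<Rightarrow> real"
  assumes p: "\<And>x. x \<in> I \<Longrightarrow> 0 \<le> p x" "sum p I = 1"
  shows "0 \<le> ln (card I) + (\<Sum>x\<in>I. p x * ln (p x))" and "(\<Sum>x\<in>I. p x * ln (p x)) \<le> 0"
proof -
  \<comment> \<open>Sums over infinite or empty sets are \<open>0\<close> by convention, which
    \<open>sum p I = 1\<close> excludes.\<close>
  have "finite I" "I \<noteq> {}" using p(2) by (auto intro: ccontr)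
  then have n: "0 < real (card I)" by (simp add: card_gt_0_iff)
  have "(\<Sum>x\<in>I. \<bar>p x - 1 / card I\<bar>)\<^sup>2 \<le> 4 * (\<Sum>x\<in>I. p x * (ln (p x) - ln (1 / card I)))"
    using p n by (intro kl_tv) auto
  also have "(\<Sum>x\<in>I. p x * (ln (p x) - ln (1 / card I))) = (\<Sum>x\<in>I. p x * ln (p x)) + ln (card I)"
    using p n by (simp add: ln_div algebra_simps sum.distrib sum_distrib_right[symmetric])
  finally show "0 \<le> ln (card I) + (\<Sum>x\<in>I. p x * ln (p x))"
    using order_trans[OF zero_le_power2] by (smt (verit))
  have "p x \<le> 1" if "x \<in> I" for x
    using member_le_sum[OF that, of p] p \<open>finite I\<close> by auto
  then have "p x * ln (p x) \<le> 0" if "x \<in> I" for x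
    using that p by (cases "p x = 0") (auto simp: mult_nonneg_nonpos ln_le_zero_iff less_le)
  then show "(\<Sum>x\<in>I. p x * ln (p x)) \<le> 0" by (rule sum_nonpos)
qed

section \<open>Transition probabilities and the semigroup property\<close>

context markov_chain
begin

text \<open>This keeps the simplifier from rewriting \<open>{1..n}\<close> to
  \<open>{Suc 0..n}\<close>.\<close>

context notes One_nat_def [simp del]
begin

definition trans_prob :: "real \<Rightarrow> nat \<Rightarrow> nat \<Rightarrow> real" where
  "trans_prob t a b = measure (X a) {\<omega> \<in> paths n. \<omega> t = b}"

lemma space_law: "a \<in> {1..n} \<Longrightarrow> space (X a) = paths n"
  using sets_eq_imp_space_eq[OF sets_law, of a]
  by (auto simp: path_space_def space_restrict_space space_PiM paths_def)

lemma measurable_at: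
  assumes "a \<in> {1..n}" "0 \<le> t"
  shows "(\<lambda>\<omega>. \<omega> t) \<in> measurable (X a) (count_space {1..n})"
proof -
  have "(\<lambda>\<omega>. \<omega> t) \<in> measurable (path_space n) (count_space {1..n})"
    unfolding path_space_def using assms
    by (intro measurable_restrict_space1 measurable_component_singleton) auto
  then show ?thesis using sets_law[OF assms(1)] by (simp cong: measurable_cong_sets)
qed

lemma measure_law_at:
  assumes "a \<in> {1..n}" "0 \<le> t" "b \<in> {1..n}"
  shows "measure (law_at n X a t) {b} = trans_prob t a b"
  unfolding law_at_def trans_prob_def using assms
  by (subst measure_distr[OF measurable_at])
    (auto simp: space_law intro!: arg_cong[where f = "measure (X a)"])

lemma sets_at:
  assumes "a \<in> {1..n}" "0 \<le> t"
  shows "{\<omega> \<in> paths n. \<omega> t = b} \<in> sets (X a)"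
proof (cases "b \<in> {1..n}")
  case True
  have "(\<lambda>\<omega>. \<omega> t) -` {b} \<inter> space (X a) \<in> sets (X a)"
    by (rule measurable_sets[OF measurable_at[OF assms]]) (use True in auto)
  then show ?thesis using assms by (simp add: space_law vimage_def Int_def conj_commute)
next
  case False
  then have "{\<omega> \<in> paths n. \<omega> t = b} = {}" using assms by (auto simp: paths_def)
  then show ?thesis by (metis sets.empty_sets)
qed

lemma trans_prob_nonneg: "0 \<le> trans_prob t a b"
  by (simp add: trans_prob_def)

lemma measure_split_at:
  assumes a: "a \<in> {1..n}" and s: "0 \<le> s" and A: "A \<in> sets (X a)"
  shows "measure (X a) A = (\<Sum>i\<in>{1..n}. measure (X a) {\<omega> \<in> A. \<omega> s = i})"
proof -
  interpret prob_space "X a" by (rule prob_space_law[OF a])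
  have Ap: "A \<subseteq> paths n" using sets.sets_into_space[OF A] space_law[OF a] by simp
  have "{\<omega> \<in> A. \<omega> s = i} = A \<inter> {\<omega> \<in> paths n. \<omega> s = i}" for i using Ap by auto
  then have S: "{\<omega> \<in> A. \<omega> s = i} \<in> sets (X a)" for i
    using A sets_at[OF a s] by simp
  have "A = (\<Union>i\<in>{1..n}. {\<omega> \<in> A. \<omega> s = i})"
    using Ap s by (auto simp: paths_def PiE_def Pi_def)
  then have "measure (X a) A = measure (X a) (\<Union>i\<in>{1..n}. {\<omega> \<in> A. \<omega> s = i})" by simp
  also have "\<dots> = (\<Sum>i\<in>{1..n}. measure (X a) {\<omega> \<in> A. \<omega> s = i})"
    using S by (intro finite_measure_finite_Union) (auto simp: disjoint_family_on_def)
  finally show ?thesis .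
qed

lemma sum_trans_prob:
  assumes "a \<in> {1..n}" "0 \<le> t"
  shows "(\<Sum>b\<in>{1..n}. trans_prob t a b) = 1"
proof -
  interpret prob_space "X a" by (rule prob_space_law) fact
  have "measure (X a) (paths n) = 1" using prob_space space_law[OF assms(1)] by simp
  moreover have "paths n \<in> sets (X a)" using space_law[OF assms(1)] by (metis sets.top)
  ultimately show ?thesis
    using measure_split_at[OF assms] by (simp add: trans_prob_def)
qed

lemma chapman_kolmogorov:
  assumes a: "a \<in> {1..n}" "j \<in> {1..n}" and st: "0 \<le> s" "0 \<le> t"
  shows "trans_prob (s + t) a j = (\<Sum>i\<in>{1..n}. trans_prob s a i * trans_prob t i j)"
proof -
  have "trans_prob (s + t) a j =
      (\<Sum>i\<in>{1..n}. measure (X a) {\<omega> \<in> {\<omega> \<in> paths n. \<omega> (s + t) = j}. \<omega> s = i})"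
    unfolding trans_prob_def using sets_at[OF a(1), of "s + t" j] st
    by (intro measure_split_at a) auto
  also have "\<dots> = (\<Sum>i\<in>{1..n}. measure (X a) {\<omega> \<in> paths n. \<omega> s = i \<and> \<omega> (s + t) = j})"
    by (intro sum.cong refl arg_cong[where f = "measure (X a)"]) auto
  also have "\<dots> = (\<Sum>i\<in>{1..n}. trans_prob s a i * trans_prob t i j)"
    \<comment> \<open>The Markov property for the trivial past event
      \<open>A = paths n\<close>.\<close>
    unfolding trans_prob_def using a st
    by (intro sum.cong refl markov) (auto simp: past_def intro: sigma_sets_top)
  finally show ?thesis .
qed

section \<open>Distance between the laws from two initial states\<close>

lemma tv_dist_law_at:
  assumes "a \<in> {1..n}" "b \<in> {1..n}" "0 \<le> s" "0 \<le> t"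
  shows "tv_dist n (law_at n X a s) (law_at n X b t) =
    (\<Sum>i\<in>{1..n}. \<bar>trans_prob s a i - trans_prob t b i\<bar>)"
  unfolding tv_dist_def using assms by (simp add: measure_law_at)

text \<open>By Chapman-Kolmogorov the difference of the laws evolves by a stochastic matrix, which
  contracts the \<open>l1\<close> norm: triangle inequality, then row sums \<open>1\<close>.\<close>

lemma tv_dist_law_at_mono:
  assumes ab: "a \<in> {1..n}" "b \<in> {1..n}" and "0 \<le> s" "s \<le> t"
  shows "tv_dist n (law_at n X a t) (law_at n X b t) \<le> tv_dist n (law_at n X a s) (law_at n X b s)"
proof -
  define u where "u = t - s"
  have u: "0 \<le> u" "t = s + u" using \<open>s \<le> t\<close> by (auto simp: u_def)
  let ?d = "\<lambda>i. trans_prob s a i - trans_prob s b i"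
  have "(\<Sum>j\<in>{1..n}. \<bar>trans_prob t a j - trans_prob t b j\<bar>)
      = (\<Sum>j\<in>{1..n}. \<bar>\<Sum>i\<in>{1..n}. ?d i * trans_prob u i j\<bar>)"
    unfolding u(2) using ab u(1) \<open>0 \<le> s\<close>
    by (intro sum.cong) (simp_all add: chapman_kolmogorov left_diff_distrib sum_subtractf)
  also have "\<dots> \<le> (\<Sum>j\<in>{1..n}. \<Sum>i\<in>{1..n}. \<bar>?d i\<bar> * trans_prob u i j)"
    by (intro sum_mono order_trans[OF sum_abs]) (simp add: abs_mult trans_prob_nonneg)
  also have "\<dots> = (\<Sum>i\<in>{1..n}. \<bar>?d i\<bar> * (\<Sum>j\<in>{1..n}. trans_prob u i j))"
    by (subst sum.swap) (simp add: sum_distrib_left)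
  also have "\<dots> = (\<Sum>i\<in>{1..n}. \<bar>?d i\<bar>)"
    using u(1) by (simp add: sum_trans_prob)
  finally show ?thesis
    using assms by (simp add: tv_dist_law_at)
qed

text \<open>The trivial bound \<open>2\<close> in a form proportional to \<open>ln n\<close>, as the
  final estimate requires: the right-hand side is at least \<open>2\<close> for \<open>n\<close> at
  least \<open>2\<close>, and for \<open>n = 1\<close> both sides vanish.\<close>

lemma tv_dist_law_at_le:
  assumes ab: "a \<in> {1..n}" "b \<in> {1..n}" and "0 \<le> t"
  shows "tv_dist n (law_at n X a t) (law_at n X b t) \<le> 2 * ln n / ln 2"
proof (cases "n = 1")
  case True
  then show ?thesis using assms True by (simp add: tv_dist_def)
next
  case False
  have "(\<Sum>i\<in>{1..n}. \<bar>trans_prob t a i - trans_prob t b i\<bar>)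
      \<le> (\<Sum>i\<in>{1..n}. trans_prob t a i + trans_prob t b i)"
    by (intro sum_mono order_trans[OF abs_triangle_ineq4]) (simp add: trans_prob_nonneg)
  also have "\<dots> = 2" using assms by (simp add: sum.distrib sum_trans_prob)
  also have "\<dots> \<le> 2 * ln n / ln 2" using False ab by (auto simp: field_simps)
  finally show ?thesis using assms by (simp add: tv_dist_law_at)
qed

section \<open>Entropy of the law of the chain\<close>

text \<open>Relative entropy with respect to the uniform distribution, with \<open>ln n\<close>
  taken out of the sum.\<close>

definition entropy_at :: "nat \<Rightarrow> real \<Rightarrow> real" where
  "entropy_at a t = ln n + (\<Sum>i\<in>{1..n}. trans_prob t a i * ln (trans_prob t a i))"

lemma entropy_at_bounds:
  assumes "a \<in> {1..n}" "0 \<le> t"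
  shows "0 \<le> entropy_at a t" and "entropy_at a t \<le> ln n"
  using entropy_bounds[of "{1..n}" "trans_prob t a"] assms
  by (auto simp: entropy_at_def sum_trans_prob trans_prob_nonneg)

lemma trans_prob_sym:
  assumes "reversible_wrt n X (pmf_of_set {1..n})" "a \<in> {1..n}" "b \<in> {1..n}" "0 \<le> t"
  shows "trans_prob t a b = trans_prob t b a"
  using assms by (auto simp: reversible_wrt_def measure_law_at)

text \<open>\<open>entropy_drop\<close> for the matrix \<open>trans_prob s\<close>, symmetric by
  reversibility; Chapman-Kolmogorov identifies \<open>r\<close> and \<open>q\<close> with the laws
  at \<open>t + s\<close> and \<open>t + 2 * s\<close>.\<close>

lemma entropy_at_drop:
  assumes rev: "reversible_wrt n X (pmf_of_set {1..n})" and a: "a \<in> {1..n}" and st: "0 \<le> t" "0 \<le> s"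
  shows "(tv_dist n (law_at n X a (t + 2 * s)) (law_at n X a t))\<^sup>2
    \<le> 4 * (entropy_at a t - entropy_at a (t + s))"
proof -
  have ck: "trans_prob (t + s + s) a y = (\<Sum>i\<in>{1..n}. trans_prob (t + s) a i * trans_prob s i y)"
    if "y \<in> {1..n}" for y
    using chapman_kolmogorov[OF a that, of "t + s" s] st by simp
  have "(\<Sum>i\<in>{1..n}. \<bar>trans_prob t a i - trans_prob ((t + s) + s) a i\<bar>)\<^sup>2
    \<le> 4 * ((\<Sum>i\<in>{1..n}. trans_prob t a i * ln (trans_prob t a i))
      - (\<Sum>i\<in>{1..n}. trans_prob (t + s) a i * ln (trans_prob (t + s) a i)))"
  proof (rule entropy_drop[where P = "trans_prob s"])
    show "\<And>x y. x \<in> {1..n} \<Longrightarrow> y \<in> {1..n} \<Longrightarrow> trans_prob s x y = trans_prob s y x"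
      using trans_prob_sym[OF rev] st by blast
    show "\<And>y. y \<in> {1..n} \<Longrightarrow> trans_prob (t + s) a y = (\<Sum>i\<in>{1..n}. trans_prob t a i * trans_prob s i y)"
      using chapman_kolmogorov[OF a _ st] by blast
  qed (use a st ck in \<open>simp_all add: trans_prob_nonneg sum_trans_prob\<close>)
  then show ?thesis
    using a st by (simp add: tv_dist_law_at entropy_at_def abs_minus_commute add.assoc)
qed

lemma entropy_at_mono:
  assumes "reversible_wrt n X (pmf_of_set {1..n})" "a \<in> {1..n}" "0 \<le> s" "s \<le> t"
  shows "entropy_at a t \<le> entropy_at a s"
  using entropy_at_drop[OF assms(1,2), of s "t - s"] assms(3,4)
  by (smt (verit) zero_le_power2)

end

end

theorem theorem3:
  "\<forall>\<delta>::real. \<delta> > 0 \<longrightarrow>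
     (\<exists>(C::real) (C'::real). C > 0 \<and> C' > 0 \<and>
       (\<forall>(n::nat) X. n \<ge> 1 \<longrightarrow> markov_chain n X \<longrightarrow> irreducible_chain n X \<longrightarrow>
          reversible_wrt n X (pmf_of_set {1..n}) \<longrightarrow>
          (\<forall>a\<in>{1..n}.
             (\<integral>\<^sup>+t\<in>{0..}. ennreal
                (indicator {t. 0 \<le> t \<and> tv_dist n (law_at n X a (3 * t)) (law_at n X a t) \<ge> \<delta>} t * (1 / t))
                \<partial>lborel) \<le> ennreal (C * ln (real n))) \<and>
          (\<forall>a\<in>{1..n}. \<forall>b\<in>{1..n}.
             (\<integral>\<^sup>+t\<in>{0..}. ennreal
                (indicator {t. 0 \<le> t \<and>
                     tv_dist n (law_at n X a t) (law_at n X b t)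
                     - tv_dist n (law_at n X a (3 * t)) (law_at n X b (3 * t)) \<ge> \<delta>} t * (1 / t))
                \<partial>lborel) \<le> ennreal (C' * ln (real n)))))"
proof (intro allI impI exI conjI ballI)
  fix \<delta> :: real assume "0 < \<delta>"
  \<comment> \<open>Both constants come from \<open>M * ln c / \<eta>\<close> in
    \<open>nn_integral_large_drop_le\<close>: in (a) with \<open>M = ln n\<close>,
    \<open>c = 2\<close>, \<open>\<eta> = \<delta>\<^sup>2 / 4\<close>, in (b) with
    \<open>M = 2 * ln n / ln 2\<close>, \<open>c = 3\<close>,
    \<open>\<eta> = \<delta>\<close>.\<close>
  then show "0 < 4 * ln 2 / \<delta>\<^sup>2" "0 < 2 * ln 3 / (ln 2 * \<delta>)" by simp_all
  fix n :: nat and X and a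
  assume "markov_chain n X" and rev: "reversible_wrt n X (pmf_of_set {1..n})" and a: "a \<in> {1..n}"
  interpret markov_chain n X by fact
  have "(\<integral>\<^sup>+t\<in>{0..}. ennreal
      (indicator {t. 0 \<le> t \<and> tv_dist n (law_at n X a (3 * t)) (law_at n X a t) \<ge> \<delta>} t * (1 / t))
      \<partial>lborel) \<le> ennreal (ln n * ln 2 / (\<delta>\<^sup>2 / 4))"
  proof (rule nn_integral_large_drop_le[where h = "entropy_at a"])
    fix t assume "t \<in> {t. 0 \<le> t \<and> tv_dist n (law_at n X a (3 * t)) (law_at n X a t) \<ge> \<delta>}"
    then have t: "0 \<le> t" "\<delta> \<le> tv_dist n (law_at n X a (3 * t)) (law_at n X a t)" by auto
    then have "\<delta>\<^sup>2 \<le> (tv_dist n (law_at n X a (3 * t)) (law_at n X a t))\<^sup>2"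
      using \<open>0 < \<delta>\<close> by (intro power_mono) auto
    \<comment> \<open>With time step \<open>s = t\<close>, the distance between times
      \<open>t\<close> and \<open>3 * t\<close> is controlled by the entropy drop from
      \<open>t\<close> to \<open>2 * t\<close>; hence \<open>c = 2\<close> although the distance
      involves \<open>3 * t\<close>.\<close>
    with t entropy_at_drop[OF rev a, of t t]
    show "0 \<le> t \<and> \<delta>\<^sup>2 / 4 \<le> entropy_at a t - entropy_at a (2 * t)" by (simp add: field_simps)
  qed (use entropy_at_mono[OF rev a] entropy_at_bounds[OF a] \<open>0 < \<delta>\<close> in auto)
  then show "(\<integral>\<^sup>+t\<in>{0..}. ennreal
      (indicator {t. 0 \<le> t \<and> tv_dist n (law_at n X a (3 * t)) (law_at n X a t) \<ge> \<delta>} t * (1 / t))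
      \<partial>lborel) \<le> ennreal (4 * ln 2 / \<delta>\<^sup>2 * ln n)"
    by (simp add: algebra_simps)
  fix b assume b: "b \<in> {1..n}"
  have "(\<integral>\<^sup>+t\<in>{0..}. ennreal
      (indicator {t. 0 \<le> t \<and> tv_dist n (law_at n X a t) (law_at n X b t)
        - tv_dist n (law_at n X a (3 * t)) (law_at n X b (3 * t)) \<ge> \<delta>} t * (1 / t))
      \<partial>lborel) \<le> ennreal (2 * ln n / ln 2 * ln 3 / \<delta>)"
    using tv_dist_law_at_mono[OF a b] tv_dist_law_at_le[OF a b] \<open>0 < \<delta>\<close>
    by (intro nn_integral_large_drop_le[where h = "\<lambda>t. tv_dist n (law_at n X a t) (law_at n X b t)"])
      (auto simp: tv_dist_def intro: sum_nonneg)
  then show "(\<integral>\<^sup>+t\<in>{0..}. ennreal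
      (indicator {t. 0 \<le> t \<and> tv_dist n (law_at n X a t) (law_at n X b t)
        - tv_dist n (law_at n X a (3 * t)) (law_at n X b (3 * t)) \<ge> \<delta>} t * (1 / t))
      \<partial>lborel) \<le> ennreal (2 * ln 3 / (ln 2 * \<delta>) * ln n)"
    by (simp add: algebra_simps)
qed

end
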